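(* Let $\Bbbk$ be an algebraically closed field of arbitrary characteristic. Let $R$ be a commutative $\Bbbk$-algebra realized by the retracts $\{S_\ell \mid \ell\in\Lambda\}$, with maps $\iota_\ell\colon S_\ell\hookrightarrow R$ and $\pi_\ell\colon R\twoheadrightarrow S_\ell$. Let $\delta\colon R\to R$ be a $\Bbbk$-linear map, let $i\ge 0$ be an integer, and for $\ell\in\Lambda$ set $\delta_\ell := \pi_\ell\circ\delta\circ\iota_\ell\colon S_\ell\to S_\ell$. Then $\delta\in D^i(R)$ if and only if the following two conditions hold: (1) $\delta_\ell\in D^i(S_\ell)$ for all $\ell\in\Lambda$; (2) for every $\ell\in\Lambda$ and every $f\in R$, if $\pi_\ell(f)=0$, then $\pi_\ell(\delta(f))=0$.
   Context: Realized by retracts: let $\{S_\ell\}_{\ell\in\Lambda}$ be a finite collection of domains that are algebra retracts of $R$, i.e. for each $\ell$ there are $\Bbbk$-algebra homomorphisms $\iota_\ell\colon S_\ell\to R$ (injective) and $\pi_\ell\colon R\to S_\ell$ (surjective) with $\pi_\ell\circ\iota_\ell=\mathrm{id}_{S_\ell}$. Put $P_\ell=\ker\pi_\ell$. One says that $R$ is realized by the retracts $\{S_\ell\mid \ell\in\Lambda\}$ if (i) $\bigcap_{\ell\in\Lambda}P_\ell=0$, equivalently the map $\phi\colon R\to\bigoplus_{\ell\in\Lambda}S_\ell$, $f\mapsto(\pi_\ell(f))_{\ell\in\Lambda}$, is injective; and (ii) for each $i\in\Lambda$, $\bigcap_{\ell\in\Lambda,\,\ell\ne i}P_\ell\neq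 0$. Differential operators: for a commutative $\Bbbk$-algebra $R$, $D^0(R)=\mathrm{Hom}_R(R,R)$, and for $i>0$, $D^i(R)=\{\delta\in\mathrm{Hom}_\Bbbk(R,R)\mid [\delta,r]\in D^{i-1}(R)\text{ for all } r\in R\}$, where $[\delta,r]=\delta\circ r-r\circ\delta$ and $r$ denotes multiplication by $r$. $D(R)=\bigcup_{i\ge0}D^i(R)$. *)

theory Defs
  imports "HOL-Algebra.Algebraic_Closure"
begin

text \<open>
  Linear maps are total HOL functions of which only the values on the carrier matter; they are not
  required to be extensional, as for \<^const>\<open>ring_hom\<close>. All notions below depend only on
  the restrictions of the maps to the carriers.
\<close>

definition lin_hom ::
  "('a, 'c) ring_scheme \<Rightarrow> ('a, 'm, 'd) module_scheme \<Rightarrow> ('a, 'n, 'e) module_scheme \<Rightarrow> ('m \<Rightarrow> 'n) set"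
  where "lin_hom A M N =
    {h \<in> carrier M \<rightarrow> carrier N.
      (\<forall>x\<in>carrier M. \<forall>y\<in>carrier M. h (x \<oplus>\<^bsub>M\<^esub> y) = h x \<oplus>\<^bsub>N\<^esub> h y) \<and>
      (\<forall>a\<in>carrier A. \<forall>x\<in>carrier M. h (a \<odot>\<^bsub>M\<^esub> x) = a \<odot>\<^bsub>N\<^esub> h x)}"

definition alg_hom ::
  "('k, 'c) ring_scheme \<Rightarrow> ('k, 'a, 'd) module_scheme \<Rightarrow> ('k, 'b, 'e) module_scheme \<Rightarrow> ('a \<Rightarrow> 'b) set"
  where "alg_hom K A B = ring_hom A B \<inter> lin_hom K A B"

text \<open>
  The scalar multiplication carried by the record of a \<open>K\<close>-algebra \<open>R\<close> is that of
  \<open>K\<close>; in order to speak of \<open>R\<close>-linear maps it is replaced by the product of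
  \<open>R\<close>.
\<close>

definition regular_module :: "('a, 'c) ring_scheme \<Rightarrow> ('a, 'a) module"
  where "regular_module R =
    \<lparr>carrier = carrier R, monoid.mult = monoid.mult R, one = one R, zero = zero R, add = add R,
     smult = monoid.mult R\<rparr>"

definition commutator :: "('a, 'c) ring_scheme \<Rightarrow> ('a \<Rightarrow> 'a) \<Rightarrow> 'a \<Rightarrow> 'a \<Rightarrow> 'a"
  where "commutator R \<delta> r = (\<lambda>f. \<delta> (r \<otimes>\<^bsub>R\<^esub> f) \<ominus>\<^bsub>R\<^esub> r \<otimes>\<^bsub>R\<^esub> \<delta> f)"

primrec diff_op ::
  "('k, 'c) ring_scheme \<Rightarrow> ('k, 'a, 'd) module_scheme \<Rightarrow> nat \<Rightarrow> ('a \<Rightarrow> 'a) set"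
  where
    "diff_op K R 0 = lin_hom R (regular_module R) (regular_module R)"
  | "diff_op K R (Suc i) =
      {\<delta> \<in> lin_hom K R R. \<forall>r\<in>carrier R. commutator R \<delta> r \<in> diff_op K R i}"

definition algebra_retract ::
  "('k, 'c) ring_scheme \<Rightarrow> ('k, 'a, 'd) module_scheme \<Rightarrow> ('k, 'b, 'e) module_scheme \<Rightarrow>
    ('b \<Rightarrow> 'a) \<Rightarrow> ('a \<Rightarrow> 'b) \<Rightarrow> bool"
  where "algebra_retract K R S \<iota> \<pi> \<longleftrightarrow>
    algebra K S \<and>
    \<iota> \<in> alg_hom K S R \<and> inj_on \<iota> (carrier S) \<and>
    \<pi> \<in> alg_hom K R S \<and> \<pi> ` carrier R = carrier S \<and>
    (\<forall>s\<in>carrier S. \<pi> (\<iota> s) = s)"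

text \<open>
  The algebras \<open>S l\<close> share one carrier type; this is no restriction, since a family of
  algebras can be transported into the sum of their types. The intersection of the
  empty family of ideals of \<open>R\<close> is \<open>R\<close>, hence the explicit intersection with the carrier.
\<close>

definition realized_by_retracts ::
  "('k, 'c) ring_scheme \<Rightarrow> ('k, 'a, 'd) module_scheme \<Rightarrow> 'l set \<Rightarrow>
    ('l \<Rightarrow> ('k, 'b, 'e) module_scheme) \<Rightarrow> ('l \<Rightarrow> 'b \<Rightarrow> 'a) \<Rightarrow> ('l \<Rightarrow> 'a \<Rightarrow> 'b) \<Rightarrow> bool"
  where "realized_by_retracts K R \<Lambda> S \<iota> \<pi> \<longleftrightarrow>
    finite \<Lambda> \<and>
    (\<forall>l\<in>\<Lambda>. domain (S l) \<and> algebra_retract K R (S l) (\<iota> l) (\<pi> l)) \<and>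
    carrier R \<inter> (\<Inter>l\<in>\<Lambda>. a_kernel R (S l) (\<pi> l)) = {\<zero>\<^bsub>R\<^esub>} \<and>
    (\<forall>i\<in>\<Lambda>. carrier R \<inter> (\<Inter>l\<in>\<Lambda> - {i}. a_kernel R (S l) (\<pi> l)) \<noteq> {\<zero>\<^bsub>R\<^esub>})"

end

theory Submission
  imports Defs
begin

text \<open>
  The idea is that every differential operator \<open>\<delta>\<close> of \<open>R\<close> preserves each \<open>P\<^sub>l = ker \<pi>\<^sub>l\<close>. By
  irredundancy some \<open>g\<close> outside \<open>P\<^sub>l\<close> annihilates \<open>P\<^sub>l\<close>; for \<open>f\<close> in \<open>P\<^sub>l\<close> one has
  \<open>[\<delta>, g] f = - g (\<delta> f)\<close>, which lies in \<open>P\<^sub>l\<close> by induction on the order, and \<open>P\<^sub>l\<close> is prime.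
  Conversely, if \<open>\<delta>\<close> preserves the kernels, then \<open>\<pi>\<^sub>l \<circ> \<delta> = \<delta>\<^sub>l \<circ> \<pi>\<^sub>l\<close>, so \<open>\<pi>\<^sub>l\<close> carries
  \<open>[\<delta>, r]\<close> to \<open>[\<delta>\<^sub>l, \<pi>\<^sub>l r]\<close>, and the order of \<open>\<delta>\<close> can be tested on the \<open>S\<^sub>l\<close>, because the
  \<open>\<pi>\<^sub>l\<close> are jointly injective.
\<close>

section \<open>Linear maps, differential operators and commutators on the carrier\<close>

lemma lin_hom_regular_module:
  "lin_hom R (regular_module R) (regular_module R) =
    {h \<in> carrier R \<rightarrow> carrier R.
      (\<forall>x\<in>carrier R. \<forall>y\<in>carrier R. h (x \<oplus>\<^bsub>R\<^esub> y) = h x \<oplus>\<^bsub>R\<^esub> h y) \<and>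
      (\<forall>a\<in>carrier R. \<forall>x\<in>carrier R. h (a \<otimes>\<^bsub>R\<^esub> x) = a \<otimes>\<^bsub>R\<^esub> h x)}"
  by (simp add: lin_hom_def regular_module_def)

lemma lin_hom_closed: "h \<in> lin_hom A M N \<Longrightarrow> x \<in> carrier M \<Longrightarrow> h x \<in> carrier N"
  by (auto simp: lin_hom_def)

lemma lin_hom_add:
  "h \<in> lin_hom A M N \<Longrightarrow> x \<in> carrier M \<Longrightarrow> y \<in> carrier M \<Longrightarrow> h (x \<oplus>\<^bsub>M\<^esub> y) = h x \<oplus>\<^bsub>N\<^esub> h y"
  by (simp add: lin_hom_def)

lemma lin_hom_smult:
  "h \<in> lin_hom A M N \<Longrightarrow> a \<in> carrier A \<Longrightarrow> x \<in> carrier M \<Longrightarrow> h (a \<odot>\<^bsub>M\<^esub> x) = a \<odot>\<^bsub>N\<^esub> h x"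
  by (simp add: lin_hom_def)

lemma lin_hom_comp: "g \<in> lin_hom A N P \<Longrightarrow> h \<in> lin_hom A M N \<Longrightarrow> g \<circ> h \<in> lin_hom A M P"
  by (auto simp: lin_hom_def Pi_iff)

lemma lin_hom_cong:
  assumes "abelian_monoid M" and "\<And>a x. a \<in> carrier A \<Longrightarrow> x \<in> carrier M \<Longrightarrow> a \<odot>\<^bsub>M\<^esub> x \<in> carrier M"
    and "\<And>x. x \<in> carrier M \<Longrightarrow> g x = h x" and "g \<in> lin_hom A M N"
  shows "h \<in> lin_hom A M N"
proof -
  interpret abelian_monoid M by fact
  show ?thesis
    using assms(2-) by (auto simp: lin_hom_def Pi_iff)
qed

text \<open>Operators are total functions, and the inductions below only identify them on the
  carrier. The order sees nothing else: \<open>r\<close> times \<open>x\<close> stays in the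
  carrier, so agreement of \<open>g\<close> and \<open>h\<close> passes to their commutators with
  \<open>r\<close>.\<close>

lemma diff_op_cong:
  assumes "algebra K R" and "\<And>x. x \<in> carrier R \<Longrightarrow> g x = h x" and "g \<in> diff_op K R i"
  shows "h \<in> diff_op K R i"
  using assms(2-)
proof (induction i arbitrary: g h)
  case 0
  interpret R: cring R using assms(1) by (rule algebra.M_cring)
  from 0 show ?case
    by (auto simp: lin_hom_regular_module Pi_iff)
next
  case (Suc i)
  interpret R: cring R using assms(1) by (rule algebra.M_cring)
  interpret R_alg: algebra K R by fact
  have "h \<in> lin_hom K R R"
    by (rule lin_hom_cong[of R K g]) (use Suc.prems R.abelian_monoid_axioms in auto)
  moreover have "commutator R h r \<in> diff_op K R i" if "r \<in> carrier R" for r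
    by (rule Suc.IH[of "commutator R g r"])
       (use Suc.prems that in \<open>auto simp: commutator_def\<close>)
  ultimately show ?case by simp
qed

lemma commutator_lin_hom:
  assumes "algebra K R" and \<delta>: "\<delta> \<in> lin_hom K R R" and r: "r \<in> carrier R"
  shows "commutator R \<delta> r \<in> lin_hom K R R"
proof -
  interpret R: cring R using assms(1) by (rule algebra.M_cring)
  interpret R_alg: algebra K R by fact
  have "commutator R \<delta> r (x \<oplus>\<^bsub>R\<^esub> y) = commutator R \<delta> r x \<oplus>\<^bsub>R\<^esub> commutator R \<delta> r y"
    if "x \<in> carrier R" "y \<in> carrier R" for x y
    using that r
    by (simp add: commutator_def R.r_distr lin_hom_closed[OF \<delta>] lin_hom_add[OF \<delta>]
        R.minus_eq R.minus_add R.a_ac)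
  moreover have "commutator R \<delta> r (a \<odot>\<^bsub>R\<^esub> x) = a \<odot>\<^bsub>R\<^esub> commutator R \<delta> r x"
    if a: "a \<in> carrier K" and x: "x \<in> carrier R" for a x
  proof -
    \<comment> \<open>The algebra law extracts scalars from the left factor of a product only;
      commutativity gives the right factor.\<close>
    have *: "r \<otimes>\<^bsub>R\<^esub> (a \<odot>\<^bsub>R\<^esub> y) = a \<odot>\<^bsub>R\<^esub> (r \<otimes>\<^bsub>R\<^esub> y)" if "y \<in> carrier R" for y
      using a r that by (metis R.m_comm R_alg.smult_assoc2 R_alg.smult_closed)
    show ?thesis
      using a x r
      by (simp add: commutator_def * lin_hom_closed[OF \<delta>] lin_hom_smult[OF \<delta>]
          R.minus_eq R_alg.smult_r_distr R_alg.smult_r_minus)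
  qed
  ultimately show ?thesis
    using r by (auto simp: lin_hom_def commutator_def intro!: lin_hom_closed[OF \<delta>])
qed

section \<open>Differential operators and annihilators\<close>

text \<open>Since \<open>\<pi> g\<close> can be cancelled in the domain \<open>S\<close>, it
  suffices to kill \<open>\<pi> (g * \<delta> f)\<close>. The induction keeps \<open>f\<close> and
  \<open>g\<close> fixed and replaces \<open>\<delta>\<close> by its commutator with this one
  \<open>g\<close>, whose order is one less.\<close>

lemma diff_op_annihilator:
  assumes "ring R" and "ring_hom_ring R S \<pi>" and "domain S"
    and "\<delta> \<in> diff_op K R i" and "f \<in> carrier R" and "g \<in> carrier R"
    and "g \<otimes>\<^bsub>R\<^esub> f = \<zero>\<^bsub>R\<^esub>" and "\<pi> g \<noteq> \<zero>\<^bsub>S\<^esub>"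
  shows "\<pi> (\<delta> f) = \<zero>\<^bsub>S\<^esub>"
proof -
  interpret ring_hom_ring R S \<pi> by fact
  interpret S: domain S by fact
  have cancel: "\<pi> x = \<zero>\<^bsub>S\<^esub>" if "x \<in> carrier R" "\<pi> (g \<otimes>\<^bsub>R\<^esub> x) = \<zero>\<^bsub>S\<^esub>" for x
    using that \<open>g \<in> carrier R\<close> \<open>\<pi> g \<noteq> \<zero>\<^bsub>S\<^esub>\<close> S.integral[of "\<pi> g" "\<pi> x"] by auto
  \<comment> \<open>Stated for additive maps, so that it serves both the \<open>R\<close>-linear
    operators of order 0 and the \<open>K\<close>-linear ones of higher order.\<close>
  have add_zero: "h \<zero>\<^bsub>R\<^esub> = \<zero>\<^bsub>R\<^esub>"
    if "h \<in> carrier R \<rightarrow> carrier R"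
      and "\<And>x y. x \<in> carrier R \<Longrightarrow> y \<in> carrier R \<Longrightarrow> h (x \<oplus>\<^bsub>R\<^esub> y) = h x \<oplus>\<^bsub>R\<^esub> h y" for h
  proof -
    have "h \<zero>\<^bsub>R\<^esub> \<oplus>\<^bsub>R\<^esub> h \<zero>\<^bsub>R\<^esub> = h \<zero>\<^bsub>R\<^esub>"
      using that(2)[of "\<zero>\<^bsub>R\<^esub>" "\<zero>\<^bsub>R\<^esub>"] by simp
    then show ?thesis
      using that(1) by (metis PiE R.add.r_cancel_one R.zero_closed)
  qed
  show ?thesis
    using assms(4)
  proof (induction i arbitrary: \<delta>)
    case 0
    then have \<delta>: "\<delta> \<in> carrier R \<rightarrow> carrier R"
      "\<delta> (g \<otimes>\<^bsub>R\<^esub> f) = g \<otimes>\<^bsub>R\<^esub> \<delta> f" "\<delta> \<zero>\<^bsub>R\<^esub> = \<zero>\<^bsub>R\<^esub>"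
      using \<open>f \<in> carrier R\<close> \<open>g \<in> carrier R\<close>
      by (auto simp: lin_hom_regular_module intro!: add_zero[of \<delta>])
    then have "\<pi> (g \<otimes>\<^bsub>R\<^esub> \<delta> f) = \<zero>\<^bsub>S\<^esub>"
      using \<open>g \<otimes>\<^bsub>R\<^esub> f = \<zero>\<^bsub>R\<^esub>\<close> by (metis hom_zero)
    moreover have "\<delta> f \<in> carrier R"
      using \<delta>(1) \<open>f \<in> carrier R\<close> by blast
    ultimately show ?case
      by (simp only: cancel)
  next
    case (Suc i)
    then have \<delta>: "\<delta> \<in> lin_hom K R R" and IH: "\<pi> (commutator R \<delta> g f) = \<zero>\<^bsub>S\<^esub>"
      using \<open>g \<in> carrier R\<close> by auto
    have \<delta>f: "\<delta> f \<in> carrier R"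
      using \<delta> \<open>f \<in> carrier R\<close> by (rule lin_hom_closed)
    moreover have "\<delta> \<zero>\<^bsub>R\<^esub> = \<zero>\<^bsub>R\<^esub>"
      using lin_hom_closed[OF \<delta>] lin_hom_add[OF \<delta>] by (intro add_zero) blast+
    \<comment> \<open>The other term of the commutator is
      \<open>\<delta> (g * f) = \<delta> 0 = 0\<close>.\<close>
    ultimately have "commutator R \<delta> g f = \<ominus>\<^bsub>R\<^esub> (g \<otimes>\<^bsub>R\<^esub> \<delta> f)"
      using \<open>g \<in> carrier R\<close> \<open>g \<otimes>\<^bsub>R\<^esub> f = \<zero>\<^bsub>R\<^esub>\<close> by (simp add: commutator_def R.minus_eq)
    then have "\<ominus>\<^bsub>S\<^esub> \<pi> (g \<otimes>\<^bsub>R\<^esub> \<delta> f) = \<zero>\<^bsub>S\<^esub>"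
      using IH \<open>g \<in> carrier R\<close> \<delta>f by (metis R.m_closed hom_a_inv)
    then have "\<pi> (g \<otimes>\<^bsub>R\<^esub> \<delta> f) = \<zero>\<^bsub>S\<^esub>"
      using \<open>g \<in> carrier R\<close> \<delta>f by (metis R.m_closed S.minus_minus S.minus_zero hom_closed)
    then show ?case
      by (rule cancel[OF \<delta>f])
  qed
qed

section \<open>Compression of operators to a single retract\<close>

locale retract =
  R: cring R + S: cring S + R_alg: algebra K R + S_alg: algebra K S
  for K :: "('k, 'c) ring_scheme" and R :: "('k, 'a, 'd) module_scheme"
    and S :: "('k, 'b, 'e) module_scheme" +
  fixes \<iota> :: "'b \<Rightarrow> 'a" and \<pi> :: "'a \<Rightarrow> 'b"
  assumes \<iota>: "\<iota> \<in> alg_hom K S R" and \<pi>: "\<pi> \<in> alg_hom K R S"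
    and \<pi>_\<iota>: "s \<in> carrier S \<Longrightarrow> \<pi> (\<iota> s) = s"
begin

sublocale \<pi>: ring_hom_ring R S \<pi>
  using \<pi> R.ring_axioms S.ring_axioms by (intro ring_hom_ringI2) (auto simp: alg_hom_def)

sublocale \<iota>: ring_hom_ring S R \<iota>
  using \<iota> R.ring_axioms S.ring_axioms by (intro ring_hom_ringI2) (auto simp: alg_hom_def)

text \<open>Inside \<open>\<delta>\<close>, multiplicativity of \<open>\<iota>\<close> splits the
  product; outside, \<open>\<pi> (\<iota> s) = s\<close> recovers the factor
  \<open>s\<close>.\<close>

lemma commutator_compression:
  assumes "\<delta> \<in> carrier R \<rightarrow> carrier R" and "s \<in> carrier S" and "f \<in> carrier S"
  shows "commutator S (\<pi> \<circ> \<delta> \<circ> \<iota>) s f = (\<pi> \<circ> commutator R \<delta> (\<iota> s) \<circ> \<iota>) f"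
proof -
  have "\<delta> (\<iota> s \<otimes>\<^bsub>R\<^esub> \<iota> f) \<in> carrier R" "\<delta> (\<iota> f) \<in> carrier R"
    using assms by auto
  then show ?thesis
    using assms by (simp add: commutator_def R.minus_eq S.minus_eq \<pi>_\<iota>)
qed

text \<open>Compression does not raise the order: a commutator of the compression with
  \<open>s\<close> is the compression of a commutator with \<open>\<iota> s\<close>, to which the
  induction hypothesis applies.\<close>

lemma diff_op_compression:
  assumes "\<delta> \<in> diff_op K R i"
  shows "\<pi> \<circ> \<delta> \<circ> \<iota> \<in> diff_op K S i"
  using assms
proof (induction i arbitrary: \<delta>)
  case 0
  then have \<delta>: "\<delta> \<in> carrier R \<rightarrow> carrier R"
    "\<And>x y. x \<in> carrier R \<Longrightarrow> y \<in> carrier R \<Longrightarrow> \<delta> (x \<oplus>\<^bsub>R\<^esub> y) = \<delta> x \<oplus>\<^bsub>R\<^esub> \<delta> y"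
    "\<And>x y. x \<in> carrier R \<Longrightarrow> y \<in> carrier R \<Longrightarrow> \<delta> (x \<otimes>\<^bsub>R\<^esub> y) = x \<otimes>\<^bsub>R\<^esub> \<delta> y"
    by (auto simp: lin_hom_regular_module)
  then have "\<delta> (\<iota> s) \<in> carrier R" if "s \<in> carrier S" for s
    using that by auto
  with \<delta> show ?case
    by (auto simp: lin_hom_regular_module \<pi>_\<iota>)
next
  case (Suc i)
  then have \<delta>: "\<delta> \<in> lin_hom K R R" by simp
  have "\<pi> \<circ> \<delta> \<circ> \<iota> \<in> lin_hom K S S"
    using \<pi> \<iota> \<delta> unfolding alg_hom_def by (meson IntD2 lin_hom_comp)
  moreover have "commutator S (\<pi> \<circ> \<delta> \<circ> \<iota>) s \<in> diff_op K S i" if s: "s \<in> carrier S" for s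
  proof (rule diff_op_cong[OF S_alg.algebra_axioms])
    show "\<pi> \<circ> commutator R \<delta> (\<iota> s) \<circ> \<iota> \<in> diff_op K S i"
      using Suc.prems s by (intro Suc.IH) simp
    show "(\<pi> \<circ> commutator R \<delta> (\<iota> s) \<circ> \<iota>) f = commutator S (\<pi> \<circ> \<delta> \<circ> \<iota>) s f"
      if "f \<in> carrier S" for f
      using commutator_compression[of \<delta> s f] \<delta> s that by (auto simp: lin_hom_def)
  qed
  ultimately show ?case
    unfolding diff_op.simps by blast
qed

text \<open>As \<open>\<delta>\<close> preserves the kernel, \<open>\<pi> (\<delta> f)\<close>
  depends only on \<open>\<pi> f\<close>, and \<open>f\<close> may be replaced by the representative
  \<open>\<iota> (\<pi> f)\<close> of its class.\<close>

lemma compression_intertwines: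
  assumes \<delta>: "\<delta> \<in> lin_hom K R R"
    and ker: "\<And>f. f \<in> carrier R \<Longrightarrow> \<pi> f = \<zero>\<^bsub>S\<^esub> \<Longrightarrow> \<pi> (\<delta> f) = \<zero>\<^bsub>S\<^esub>"
    and f: "f \<in> carrier R"
  shows "(\<pi> \<circ> \<delta> \<circ> \<iota>) (\<pi> f) = \<pi> (\<delta> f)"
proof -
  let ?g = "\<iota> (\<pi> f)"
  \<comment> \<open>The component of \<open>f\<close> in the kernel, for the additive splitting of
    \<open>R\<close> into the kernel of \<open>\<pi>\<close> and the image of
    \<open>\<iota>\<close>.\<close>
  let ?k = "f \<ominus>\<^bsub>R\<^esub> ?g"
  have k: "?k \<in> carrier R" and g: "?g \<in> carrier R"
    using f by simp_all
  have "\<pi> ?k = \<zero>\<^bsub>S\<^esub>"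
    using f by (simp add: R.minus_eq \<pi>_\<iota> S.r_neg)
  then have "\<pi> (\<delta> ?k) = \<zero>\<^bsub>S\<^esub>"
    by (rule ker[OF k])
  moreover have "f = ?k \<oplus>\<^bsub>R\<^esub> ?g"
    using f g by (simp add: R.minus_eq R.a_assoc R.l_neg)
  then have "\<pi> (\<delta> f) = \<pi> (\<delta> ?k) \<oplus>\<^bsub>S\<^esub> \<pi> (\<delta> ?g)"
    using lin_hom_add[OF \<delta> k g] lin_hom_closed[OF \<delta>] k g by simp
  ultimately show ?thesis
    using lin_hom_closed[OF \<delta>] g by simp
qed

text \<open>Here \<open>r\<close> is an arbitrary element of \<open>R\<close>, not just one of the
  form \<open>\<iota> s\<close>: preservation of the kernel lets \<open>\<pi>\<close> be moved past
  \<open>\<delta>\<close> at both \<open>r * f\<close> and \<open>f\<close>.\<close>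

lemma commutator_compression_intertwines:
  assumes \<delta>: "\<delta> \<in> lin_hom K R R"
    and ker: "\<And>f. f \<in> carrier R \<Longrightarrow> \<pi> f = \<zero>\<^bsub>S\<^esub> \<Longrightarrow> \<pi> (\<delta> f) = \<zero>\<^bsub>S\<^esub>"
    and r: "r \<in> carrier R" and f: "f \<in> carrier R"
  shows "\<pi> (commutator R \<delta> r f) = commutator S (\<pi> \<circ> \<delta> \<circ> \<iota>) (\<pi> r) (\<pi> f)"
proof -
  note intertwines = compression_intertwines[OF \<delta> ker, symmetric]
  have "\<pi> (commutator R \<delta> r f) = \<pi> (\<delta> (r \<otimes>\<^bsub>R\<^esub> f)) \<ominus>\<^bsub>S\<^esub> \<pi> r \<otimes>\<^bsub>S\<^esub> \<pi> (\<delta> f)"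
    using r f by (simp add: commutator_def lin_hom_closed[OF \<delta>] R.minus_eq S.minus_eq)
  also have "\<dots> = commutator S (\<pi> \<circ> \<delta> \<circ> \<iota>) (\<pi> r) (\<pi> f)"
    using r f intertwines[of "r \<otimes>\<^bsub>R\<^esub> f"] intertwines[of f] by (simp add: commutator_def)
  finally show ?thesis .
qed

end

section \<open>Testing the order on all retracts together\<close>

text \<open>All three conditions on \<open>\<delta>\<close> (linearity, order of the compressions,
  preservation of the kernels) pass to its commutators with the order lowered by one. This leaves
  order 0, where joint injectivity of the \<open>\<pi> l\<close> decides.\<close>

lemma diff_op_of_compressions:
  assumes ret: "\<And>l. l \<in> \<Lambda> \<Longrightarrow> retract K R (S l) (\<iota> l) (\<pi> l)"
    and "algebra K R"
    and inj: "\<And>f. f \<in> carrier R \<Longrightarrow> (\<And>l. l \<in> \<Lambda> \<Longrightarrow> \<pi> l f = \<zero>\<^bsub>S l\<^esub>) \<Longrightarrow> f = \<zero>\<^bsub>R\<^esub>"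
    and "\<delta> \<in> lin_hom K R R"
    and "\<And>l. l \<in> \<Lambda> \<Longrightarrow> \<pi> l \<circ> \<delta> \<circ> \<iota> l \<in> diff_op K (S l) i"
    and "\<And>l f. l \<in> \<Lambda> \<Longrightarrow> f \<in> carrier R \<Longrightarrow> \<pi> l f = \<zero>\<^bsub>S l\<^esub> \<Longrightarrow> \<pi> l (\<delta> f) = \<zero>\<^bsub>S l\<^esub>"
  shows "\<delta> \<in> diff_op K R i"
  using assms(4-)
proof (induction i arbitrary: \<delta>)
  case 0
  interpret R: cring R using assms(2) by (rule algebra.M_cring)
  note closed = lin_hom_closed[OF 0(1)]
  have "\<delta> (a \<otimes>\<^bsub>R\<^esub> x) = a \<otimes>\<^bsub>R\<^esub> \<delta> x" if a: "a \<in> carrier R" and x: "x \<in> carrier R" for a x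
  proof -
    \<comment> \<open>\<open>R\<close>-linearity is the vanishing of commutators, and an element
      vanishes once every \<open>\<pi> l\<close> kills it.\<close>
    have "commutator R \<delta> a x = \<zero>\<^bsub>R\<^esub>"
    proof (rule inj)
      show "commutator R \<delta> a x \<in> carrier R"
        using a x closed by (simp add: commutator_def)
      fix l assume l: "l \<in> \<Lambda>"
      then interpret retract K R "S l" "\<iota> l" "\<pi> l" by (rule ret)
      have "(\<pi> l \<circ> \<delta> \<circ> \<iota> l) (\<pi> l a \<otimes>\<^bsub>S l\<^esub> \<pi> l x) = \<pi> l a \<otimes>\<^bsub>S l\<^esub> (\<pi> l \<circ> \<delta> \<circ> \<iota> l) (\<pi> l x)"
        using 0(2)[OF l] a x by (simp add: lin_hom_regular_module)
      moreover have "(\<pi> l \<circ> \<delta> \<circ> \<iota> l) (\<pi> l x) \<in> carrier (S l)"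
        using x closed by simp
      ultimately show "\<pi> l (commutator R \<delta> a x) = \<zero>\<^bsub>S l\<^esub>"
        using commutator_compression_intertwines[OF 0(1) 0(3)[OF l] a x] a
        by (simp add: commutator_def S.minus_eq S.r_neg)
    qed
    then show ?thesis
      using a x closed by (simp add: commutator_def R.r_right_minus_eq)
  qed
  with 0(1) show ?case
    unfolding diff_op.simps lin_hom_regular_module by (simp add: lin_hom_def)
next
  case (Suc i)
  interpret R: cring R using assms(2) by (rule algebra.M_cring)
  note closed = lin_hom_closed[OF Suc.prems(1)]
  have "commutator R \<delta> r \<in> diff_op K R i" if r: "r \<in> carrier R" for r
  proof (rule Suc.IH)
    show "commutator R \<delta> r \<in> lin_hom K R R"
      using assms(2) Suc.prems(1) r by (rule commutator_lin_hom)
  next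
    fix l assume l: "l \<in> \<Lambda>"
    then interpret retract K R "S l" "\<iota> l" "\<pi> l" by (rule ret)
    note intertwines = commutator_compression_intertwines[OF Suc.prems(1) Suc.prems(3)[OF l] r]
    show "\<pi> l \<circ> commutator R \<delta> r \<circ> \<iota> l \<in> diff_op K (S l) i"
    proof (rule diff_op_cong[OF S_alg.algebra_axioms])
      \<comment> \<open>On the carrier, the compression of the commutator with \<open>r\<close> is
        the commutator of the compression with \<open>\<pi> l r\<close>, because
        \<open>\<pi> l (\<iota> l s) = s\<close>.\<close>
      show "commutator (S l) (\<pi> l \<circ> \<delta> \<circ> \<iota> l) (\<pi> l r) \<in> diff_op K (S l) i"
        using Suc.prems(2)[OF l] \<pi>.hom_closed[OF r] unfolding diff_op.simps by blast
      show "commutator (S l) (\<pi> l \<circ> \<delta> \<circ> \<iota> l) (\<pi> l r) s = (\<pi> l \<circ> commutator R \<delta> r \<circ> \<iota> l) s"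
        if "s \<in> carrier (S l)" for s
        using intertwines[of "\<iota> l s"] that by (simp add: \<pi>_\<iota>)
    qed
    show "\<pi> l (commutator R \<delta> r f) = \<zero>\<^bsub>S l\<^esub>"
      if f: "f \<in> carrier R" and "\<pi> l f = \<zero>\<^bsub>S l\<^esub>" for f
    proof -
      \<comment> \<open>The kernel is an ideal, so it contains \<open>r * f\<close> as well as
        \<open>f\<close>, and \<open>\<delta>\<close> preserves it.\<close>
      have "\<pi> l (\<delta> (r \<otimes>\<^bsub>R\<^esub> f)) = \<zero>\<^bsub>S l\<^esub>" "\<pi> l (\<delta> f) = \<zero>\<^bsub>S l\<^esub>"
        using that r by (auto intro!: Suc.prems(3)[OF l])
      then show ?thesis
        using f r closed by (simp add: commutator_def R.minus_eq)
    qed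
  qed
  with Suc.prems(1) show ?case by simp
qed

theorem theorem2p6:
  fixes K :: "('k, 'c) ring_scheme"
    and R :: "('k, 'a, 'd) module_scheme"
    and \<Lambda> :: "'l set"
    and S :: "'l \<Rightarrow> ('k, 'b, 'e) module_scheme"
    and \<iota> :: "'l \<Rightarrow> 'b \<Rightarrow> 'a"
    and \<pi> :: "'l \<Rightarrow> 'a \<Rightarrow> 'b"
    and \<delta> :: "'a \<Rightarrow> 'a"
    and i :: nat
  assumes "algebraically_closed K"
    and "algebra K R"
    and "realized_by_retracts K R \<Lambda> S \<iota> \<pi>"
    and "\<delta> \<in> lin_hom K R R"
  shows "\<delta> \<in> diff_op K R i \<longleftrightarrow>
    (\<forall>l\<in>\<Lambda>. \<pi> l \<circ> \<delta> \<circ> \<iota> l \<in> diff_op K (S l) i) \<and>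
    (\<forall>l\<in>\<Lambda>. \<forall>f\<in>carrier R. \<pi> l f = \<zero>\<^bsub>S l\<^esub> \<longrightarrow> \<pi> l (\<delta> f) = \<zero>\<^bsub>S l\<^esub>)"
proof -
  interpret R: cring R using assms(2) by (rule algebra.M_cring)
  have ret: "retract K R (S l) (\<iota> l) (\<pi> l)" and dom: "domain (S l)" if "l \<in> \<Lambda>" for l
    using assms(2,3) that
    by (auto simp: realized_by_retracts_def algebra_retract_def retract_def retract_axioms_def
        algebra.M_cring)
  have "carrier R \<inter> (\<Inter>l\<in>\<Lambda>. a_kernel R (S l) (\<pi> l)) = {\<zero>\<^bsub>R\<^esub>}"
    using assms(3) by (simp add: realized_by_retracts_def)
  then have inj: "f = \<zero>\<^bsub>R\<^esub>" if "f \<in> carrier R" "\<And>l. l \<in> \<Lambda> \<Longrightarrow> \<pi> l f = \<zero>\<^bsub>S l\<^esub>" for f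
    using that unfolding a_kernel_def' by blast
  have "\<pi> l (\<delta> f) = \<zero>\<^bsub>S l\<^esub>"
    if \<delta>: "\<delta> \<in> diff_op K R i" and l: "l \<in> \<Lambda>" and f: "f \<in> carrier R" and "\<pi> l f = \<zero>\<^bsub>S l\<^esub>" for l f
  proof -
    interpret retract K R "S l" "\<iota> l" "\<pi> l" using l by (rule ret)
    \<comment> \<open>Differing from \<open>{0}\<close> yields a nonzero element only once the
      intersection is known to contain 0.\<close>
    have zero: "\<zero>\<^bsub>R\<^esub> \<in> carrier R \<inter> (\<Inter>m\<in>\<Lambda> - {l}. a_kernel R (S m) (\<pi> m))"
    proof -
      have "\<pi> m \<zero>\<^bsub>R\<^esub> = \<zero>\<^bsub>S m\<^esub>" if "m \<in> \<Lambda>" for m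
      proof -
        interpret m: retract K R "S m" "\<iota> m" "\<pi> m" using that by (rule ret)
        show ?thesis by simp
      qed
      then show ?thesis by (auto simp: a_kernel_def')
    qed
    have "carrier R \<inter> (\<Inter>m\<in>\<Lambda> - {l}. a_kernel R (S m) (\<pi> m)) \<noteq> {\<zero>\<^bsub>R\<^esub>}"
      using assms(3) l by (simp add: realized_by_retracts_def)
    \<comment> \<open>Irredundancy at \<open>l\<close> supplies \<open>g\<close>: it lies in every
      kernel other than that of \<open>\<pi> l\<close>, hence outside that one, as a nonzero element
      cannot lie in all of them.\<close>
    with zero obtain g where g: "g \<in> carrier R" "g \<noteq> \<zero>\<^bsub>R\<^esub>"
      and g_ker: "\<And>m. m \<in> \<Lambda> \<Longrightarrow> m \<noteq> l \<Longrightarrow> \<pi> m g = \<zero>\<^bsub>S m\<^esub>"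
      unfolding a_kernel_def' by blast
    have "\<pi> l g \<noteq> \<zero>\<^bsub>S l\<^esub>"
      using inj g g_ker by metis
    \<comment> \<open>Each \<open>\<pi> m\<close> kills one of the factors: \<open>f\<close> if
      \<open>m = l\<close>, and \<open>g\<close> otherwise.\<close>
    moreover have "g \<otimes>\<^bsub>R\<^esub> f = \<zero>\<^bsub>R\<^esub>"
    proof (rule inj)
      show "g \<otimes>\<^bsub>R\<^esub> f \<in> carrier R" using g f by simp
      fix m assume m: "m \<in> \<Lambda>"
      then interpret m: retract K R "S m" "\<iota> m" "\<pi> m" by (rule ret)
      show "\<pi> m (g \<otimes>\<^bsub>R\<^esub> f) = \<zero>\<^bsub>S m\<^esub>"
        using g f g_ker[OF m] \<open>\<pi> l f = \<zero>\<^bsub>S l\<^esub>\<close> by (cases "m = l") auto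
    qed
    ultimately show ?thesis
      using diff_op_annihilator[OF R.ring_axioms \<pi>.ring_hom_ring_axioms dom[OF l] \<delta> f g(1)] by simp
  qed
  moreover have "\<pi> l \<circ> \<delta> \<circ> \<iota> l \<in> diff_op K (S l) i" if "\<delta> \<in> diff_op K R i" and "l \<in> \<Lambda>" for l
    using retract.diff_op_compression[OF ret[OF that(2)] that(1)] .
  moreover have "\<delta> \<in> diff_op K R i"
    if "\<forall>l\<in>\<Lambda>. \<pi> l \<circ> \<delta> \<circ> \<iota> l \<in> diff_op K (S l) i"
      and "\<forall>l\<in>\<Lambda>. \<forall>f\<in>carrier R. \<pi> l f = \<zero>\<^bsub>S l\<^esub> \<longrightarrow> \<pi> l (\<delta> f) = \<zero>\<^bsub>S l\<^esub>"
  proof (rule diff_op_of_compressions[where \<Lambda> = \<Lambda> and S = S and \<iota> = \<iota> and \<pi> = \<pi>])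
    show "f = \<zero>\<^bsub>R\<^esub>" if "f \<in> carrier R" "\<And>l. l \<in> \<Lambda> \<Longrightarrow> \<pi> l f = \<zero>\<^bsub>S l\<^esub>" for f
      using that by (rule inj)
  qed (use that ret assms(2,4) in simp_all)
  ultimately show ?thesis by blast
qed

end
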